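(* Let $V$ be a vector space over $\mathbb{Q}$ with an inner product, and let $(V_i)_{i\in I}$ be subspaces of $V$ with linear projections $P_i:V\to V_i$ ($P_i^2=P_i$, $P_i(V)=V_i$), indexed by a partially ordered set $I$, such that: (1) $I$ has a unique minimal element $0$ and is locally finite (every interval $[i,j]=\{k:i\le k\le j\}$ is finite); (2) every $i,j\in I$ have a greatest lower bound $i\wedge j$; (3) $V_i\subseteq V_j$ whenever $i\le j$; (4) each $P_i$ is an orthogonal projection; (5) $P_iP_j=P_jP_i=P_{i\wedge j}$ for all $i,j\in I$; (6) $V=\sum_{i\in I}V_i$. Then there exist mutually orthogonal projections $T_i$ ($i\in I$) with $T_i(V)\subseteq V_i$, $T_i(V)\perp T_j(V)$ for all $i\neq j$, and \[V=\bigoplus_{i\in I}T_i(V).\] *)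

theory Defs
  imports Complex_Main
begin

text \<open>The inner product of a rational vector space takes rational values. The whole type
  \<open>'v\<close> is the vector space; its scalar multiplication is an explicit parameter.\<close>

locale rat_inner_product_space = vector_space scale
  for scale :: "rat \<Rightarrow> 'v::ab_group_add \<Rightarrow> 'v" +
  fixes ip :: "'v \<Rightarrow> 'v \<Rightarrow> rat"
  assumes ip_commute: "ip x y = ip y x"
    and ip_add_left: "ip (x + y) z = ip x z + ip y z"
    and ip_scale_left: "ip (scale c x) y = c * ip x y"
    and ip_pos: "x \<noteq> 0 \<Longrightarrow> 0 < ip x x"

definition orthogonal_sets :: "('v \<Rightarrow> 'v \<Rightarrow> rat) \<Rightarrow> 'v set \<Rightarrow> 'v set \<Rightarrow> bool" where
  "orthogonal_sets ip A B \<longleftrightarrow> (\<forall>x\<in>A. \<forall>y\<in>B. ip x y = 0)"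

definition is_projection :: "(rat \<Rightarrow> 'v::ab_group_add \<Rightarrow> 'v) \<Rightarrow> ('v \<Rightarrow> 'v) \<Rightarrow> bool" where
  "is_projection scale P \<longleftrightarrow> Vector_Spaces.linear scale scale P \<and> P \<circ> P = P"

definition is_orthogonal_projection ::
  "(rat \<Rightarrow> 'v::ab_group_add \<Rightarrow> 'v) \<Rightarrow> ('v \<Rightarrow> 'v \<Rightarrow> rat) \<Rightarrow> ('v \<Rightarrow> 'v) \<Rightarrow> bool" where
  "is_orthogonal_projection scale ip P \<longleftrightarrow>
     is_projection scale P \<and> orthogonal_sets ip {x. P x = 0} (range P)"

text \<open>Sums over an arbitrary, possibly infinite, index type are algebraic: only finitely many
  summands are nonzero.\<close>

definition decomposition ::
  "('i \<Rightarrow> 'v::ab_group_add set) \<Rightarrow> 'v \<Rightarrow> ('i \<Rightarrow> 'v) \<Rightarrow> bool" where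
  "decomposition U v x \<longleftrightarrow>
     (\<forall>i. x i \<in> U i) \<and> finite {i. x i \<noteq> 0} \<and> v = (\<Sum>i | x i \<noteq> 0. x i)"

definition subspace_sum :: "('i \<Rightarrow> 'v::ab_group_add set) \<Rightarrow> 'v set" where
  "subspace_sum U = {v. \<exists>x. decomposition U v x}"

definition is_internal_direct_sum :: "('i \<Rightarrow> 'v::ab_group_add set) \<Rightarrow> bool" where
  "is_internal_direct_sum U \<longleftrightarrow> (\<forall>v. \<exists>!x. decomposition U v x)"

end

theory Submission
  imports Defs
begin

text \<open>Inverting \<open>P i = (\<Sum>j\<le>i. T j)\<close> over the poset defines \<open>T\<close> recursively by
  \<open>T i = P i - (\<Sum>j<i. T j)\<close>. By induction \<open>P j T i\<close> is \<open>T i\<close> if \<open>i \<le> j\<close> and \<open>0\<close> otherwise: in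
  the latter case the sum over \<open>k < i\<close> reduces to the sum over \<open>k \<le> i \<and> j\<close>, which is
  \<open>P (i \<and> j)\<close>. A second induction gives \<open>T j T i = 0\<close> for \<open>i \<noteq> j\<close>. All the \<open>T i\<close> are
  self-adjoint because the \<open>P i\<close> are, so orthogonality follows from these product rules, and every
  \<open>x\<close> in \<open>V i\<close> equals \<open>P i x = (\<Sum>j\<le>i. T j x)\<close>.\<close>

lemma wf_less_if_finite_atMost:
  assumes "\<And>i::'i::order. finite {..i}"
  shows "wf {(j, i::'i). j < i}"
proof (rule wf_subset)
  show "wf (measure (\<lambda>i::'i. card {..i}))"
    by simp
  show "{(j, i::'i). j < i} \<subseteq> measure (\<lambda>i. card {..i})"
    using assms by (auto intro!: psubset_card_mono)
qed

text \<open>Minimality rules out \<open>inf z k < z\<close>, so \<open>inf z k = z\<close>. This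
  lets finite intervals starting at the minimal element bound whole down-sets.\<close>

lemma minimal_is_least:
  fixes z :: "'i::semilattice_inf"
  assumes "\<And>k. \<not> k < z"
  shows "z \<le> k"
  using assms[of "inf z k"] by (metis inf.cobounded1 inf.cobounded2 order_le_imp_less_or_eq)

section \<open>Inner products and self-adjoint projections\<close>

context rat_inner_product_space
begin

lemma ip_add_right: "ip x (y + z) = ip x y + ip x z"
  by (metis ip_add_left ip_commute)

lemma ip_diff_left: "ip (x - y) z = ip x z - ip y z"
  using ip_add_left[of "x - y" y z] by simp

lemma ip_diff_right: "ip x (y - z) = ip x y - ip x z"
  by (metis ip_diff_left ip_commute)

lemma ip_zero_left [simp]: "ip 0 y = 0"
  using ip_diff_left[of 0 0 y] by simp

lemma ip_zero_right [simp]: "ip y 0 = 0"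
  by (metis ip_zero_left ip_commute)

lemma ip_sum_left: "ip (sum f A) y = (\<Sum>a\<in>A. ip (f a) y)"
  by (induction A rule: infinite_finite_induct) (simp_all add: ip_add_left)

lemma ip_sum_right: "ip y (sum f A) = (\<Sum>a\<in>A. ip y (f a))"
  by (induction A rule: infinite_finite_induct) (simp_all add: ip_add_right)

text \<open>Since \<open>x - Q x\<close> lies in the kernel, it is orthogonal to the range, so both
  sides equal \<open>ip (Q x) (Q y)\<close>.\<close>

lemma orthogonal_projection_self_adjoint:
  assumes "is_orthogonal_projection scale ip Q"
  shows "ip (Q x) y = ip x (Q y)"
proof -
  have lin: "Vector_Spaces.linear scale scale Q" and idem: "Q (Q u) = Q u" for u
    using assms by (auto simp: is_orthogonal_projection_def is_projection_def fun_eq_iff)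
  interpret Q: Vector_Spaces.linear scale scale Q
    by (rule lin)
  have ort: "ip (u - Q u) (Q w) = 0" for u w
  proof -
    have "Q (u - Q u) = 0"
      by (simp add: Q.diff idem)
    then show ?thesis
      using assms by (auto simp: is_orthogonal_projection_def orthogonal_sets_def)
  qed
  have "ip x (Q y) = ip (Q x) (Q y)"
    using ort[of x y] by (simp add: ip_diff_left)
  moreover have "ip y (Q x) = ip (Q y) (Q x)"
    using ort[of y x] by (simp add: ip_diff_left)
  ultimately show ?thesis
    by (metis ip_commute)
qed

text \<open>If \<open>Q x = 0\<close>, moving \<open>Q\<close> across gives
  \<open>ip x (Q y) = ip (Q x) y = 0\<close>.\<close>

lemma self_adjoint_projection_orthogonal:
  assumes "is_projection scale Q" and "\<And>x y. ip (Q x) y = ip x (Q y)"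
  shows "is_orthogonal_projection scale ip Q"
  unfolding is_orthogonal_projection_def orthogonal_sets_def
  using assms by (auto simp flip: assms(2))

end

section \<open>Inverting the projections over the poset\<close>

locale meet_projections = rat_inner_product_space scale ip
  for scale :: "rat \<Rightarrow> 'v::ab_group_add \<Rightarrow> 'v" and ip :: "'v \<Rightarrow> 'v \<Rightarrow> rat" +
  fixes P :: "'i::semilattice_inf \<Rightarrow> 'v \<Rightarrow> 'v"
  assumes finite_atMost_index: "finite {..i::'i}"
    and orthogonal_projection: "is_orthogonal_projection scale ip (P i)"
    and P_P: "P i (P j x) = P (inf i j) x"
begin

lemma finite_lessThan_index: "finite {..<i::'i}"
  by (rule finite_subset[OF _ finite_atMost_index[of i]]) auto

lemma wf_index: "wf {(j, i::'i). j < i}"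
  by (rule wf_less_if_finite_atMost) (rule finite_atMost_index)

lemma index_induct [case_names less]:
  assumes "\<And>i::'i. (\<And>j. j < i \<Longrightarrow> Q j) \<Longrightarrow> Q i"
  shows "Q i"
  using wf_index by (induction i rule: wf_induct_rule) (use assms in auto)

lemma linear_P: "Vector_Spaces.linear scale scale (P i)"
  using orthogonal_projection by (simp add: is_orthogonal_projection_def is_projection_def)

lemma P_diff: "P i (x - y) = P i x - P i y"
  using linear_P[of i] by (rule Vector_Spaces.linear.axioms(3)[THEN module_hom.diff])

lemma P_sum: "P i (sum f A) = (\<Sum>a\<in>A. P i (f a))"
  using linear_P[of i] by (rule Vector_Spaces.linear.axioms(3)[THEN module_hom.sum])

text \<open>This is Moebius inversion in recursive form: \<open>T i\<close> is the sum of mu(j, i)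
  \<open>P j\<close> over \<open>j \<le> i\<close>, with the coefficients left implicit.\<close>

definition T :: "'i \<Rightarrow> 'v \<Rightarrow> 'v" where
  "T = wfrec {(j, i). j < i} (\<lambda>T i x. P i x - (\<Sum>j\<in>{..<i}. T j x))"

lemma T_rec: "T i x = P i x - (\<Sum>j\<in>{..<i}. T j x)"
  unfolding T_def by (subst wfrec[OF wf_index]) (simp add: cut_apply)

lemma P_eq_sum_T: "P i x = (\<Sum>j\<in>{..i}. T j x)"
proof -
  have "{..i} = insert i {..<i}"
    by (auto simp: order_le_less)
  then show ?thesis
    using T_rec[of i x] by (simp add: finite_lessThan_index)
qed

lemma linear_T: "Vector_Spaces.linear scale scale (T i)"
proof (induction i rule: index_induct)
  case (less i)
  interpret pair: vector_space_pair scale scale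
    by unfold_locales
  have "T i = (\<lambda>x. P i x - (\<Sum>j\<in>{..<i}. T j x))"
    by (rule ext) (rule T_rec)
  then show ?case
    using less by (auto intro!: pair.linear_compose_sub pair.linear_compose_sum linear_P)
qed

lemma T_sum: "T i (sum f A) = (\<Sum>a\<in>A. T i (f a))"
  using linear_T[of i] by (rule Vector_Spaces.linear.axioms(3)[THEN module_hom.sum])

lemma T_zero [simp]: "T i 0 = 0"
  using T_sum[of i "\<lambda>_. 0" "{}"] by simp

lemma T_self_adjoint: "ip (T i x) y = ip x (T i y)"
proof (induction i rule: index_induct)
  case (less i)
  then have "(\<Sum>j\<in>{..<i}. ip (T j x) y) = (\<Sum>j\<in>{..<i}. ip x (T j y))"
    by (intro sum.cong) auto
  then show ?case
    by (simp add: T_rec[of i] ip_diff_left ip_diff_right ip_sum_left ip_sum_right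
        orthogonal_projection_self_adjoint[OF orthogonal_projection])
qed

lemma P_T: "P j (T i x) = (if i \<le> j then T i x else 0)"
proof (induction i rule: index_induct)
  case (less i)
  have "P j (T i x) = P (inf j i) x - (\<Sum>k\<in>{..<i}. P j (T k x))"
    by (simp add: T_rec[of i] P_diff P_sum P_P)
  also have "(\<Sum>k\<in>{..<i}. P j (T k x)) = (\<Sum>k\<in>{..<i}. if k \<le> j then T k x else 0)"
    using less by (intro sum.cong) auto
  also have "\<dots> = (\<Sum>k\<in>{k\<in>{..<i}. k \<le> j}. T k x)"
    by (rule sum.inter_filter[symmetric]) (rule finite_lessThan_index)
  finally have eq: "P j (T i x) = P (inf j i) x - (\<Sum>k\<in>{k\<in>{..<i}. k \<le> j}. T k x)" .
  show ?case
  proof (cases "i \<le> j")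
    case True
    then have "inf j i = i" and "{k\<in>{..<i}. k \<le> j} = {..<i}"
      by (auto simp: inf_absorb2)
    with eq True show ?thesis
      by (simp add: T_rec[of i])
  next
    case False
    \<comment> \<open>Strictness is automatic here: \<open>k = i\<close> would give
      \<open>i \<le> j\<close>.\<close>
    then have "{k\<in>{..<i}. k \<le> j} = {..inf j i}"
      by (auto simp: order_less_le)
    with eq False show ?thesis
      by (simp add: P_eq_sum_T[of "inf j i"])
  qed
qed

lemma T_T: "T j (T i x) = (if i = j then T i x else 0)"
proof (induction j rule: index_induct)
  case (less j)
  have "T j (T i x) = P j (T i x) - (\<Sum>k\<in>{..<j}. if i = k then T i x else 0)"
    using less by (simp add: T_rec[of j])
  \<comment> \<open>If \<open>i < j\<close>, the term from \<open>P j\<close> is cancelled by the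
    summand \<open>k = i\<close>; if \<open>i = j\<close>, only the term from \<open>P j\<close>
    survives; otherwise both vanish.\<close>
  also have "\<dots> = (if i = j then T i x else 0)"
    by (auto simp: P_T finite_lessThan_index order_le_less)
  finally show ?case .
qed

section \<open>Orthogonality and the direct sum\<close>

lemma T_orthogonal_projection: "is_orthogonal_projection scale ip (T i)"
  by (rule self_adjoint_projection_orthogonal)
    (auto simp: is_projection_def fun_eq_iff linear_T T_T T_self_adjoint)

lemma range_T_subset: "range (T i) \<subseteq> range (P i)"
proof
  fix y
  assume "y \<in> range (T i)"
  then have "P i y = y"
    by (auto simp: P_T)
  then show "y \<in> range (P i)"
    by (metis rangeI)
qed

lemma orthogonal_range_T:
  assumes "i \<noteq> j"
  shows "orthogonal_sets ip (range (T i)) (range (T j))"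
  using assms by (auto simp: orthogonal_sets_def T_self_adjoint T_T)

text \<open>\<open>P i\<close> expands into the \<open>T k\<close> with \<open>k \<le> i\<close>,
  and \<open>T j\<close> kills each of them. This confines the support of
  \<open>j \<mapsto> T j v\<close> to finitely many indices.\<close>

lemma T_P_eq_0:
  assumes "\<not> j \<le> i"
  shows "T j (P i x) = 0"
  using assms by (auto simp: P_eq_sum_T[of i] T_sum T_T intro!: sum.neutral)

text \<open>Applying \<open>T j\<close> to the finite sum leaves only the component at
  \<open>j\<close>.\<close>

lemma decomposition_range_T_unique:
  assumes "decomposition (\<lambda>i. range (T i)) v y"
  shows "y j = T j v"
proof -
  have fin: "finite {i. y i \<noteq> 0}" and v: "v = (\<Sum>i | y i \<noteq> 0. y i)"
    and y: "y i \<in> range (T i)" for i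
    using assms by (auto simp: decomposition_def)
  have "T j (y i) = (if i = j then y i else 0)" for i
    using y[of i] by (auto simp: T_T)
  then show ?thesis
    using fin by (auto simp: v T_sum)
qed

lemma decomposition_range_T:
  assumes "decomposition (\<lambda>i. range (P i)) v x"
  shows "decomposition (\<lambda>i. range (T i)) v (\<lambda>j. T j v)"
proof -
  define F where "F = {i. x i \<noteq> 0}"
  \<comment> \<open>A finite down-set containing every index that can contribute, so that the two
    summations can be exchanged.\<close>
  define J where "J = (\<Union>i\<in>F. {..i})"
  have fin: "finite F" and v: "v = sum x F" and x: "x i \<in> range (P i)" for i
    using assms by (auto simp: decomposition_def F_def)
  have Px: "P i (x i) = x i" for i
    using x[of i] by (auto simp: P_P)
  have finJ: "finite J"
    unfolding J_def using fin finite_atMost_index by blast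
  have zero: "T j (x i) = 0" if "\<not> j \<le> i" for i j
    using T_P_eq_0[OF that, of "x i"] by (simp add: Px)
  have sub: "{j. T j v \<noteq> 0} \<subseteq> J"
  proof
    fix j
    assume "j \<in> {j. T j v \<noteq> 0}"
    then obtain i where "i \<in> F" "T j (x i) \<noteq> 0"
      by (auto simp: v T_sum dest: sum.not_neutral_contains_not_neutral)
    then show "j \<in> J"
      using zero[of j i] by (auto simp: J_def)
  qed
  have "(\<Sum>j | T j v \<noteq> 0. T j v) = (\<Sum>j\<in>J. T j v)"
    by (rule sum.mono_neutral_left) (use finJ sub in auto)
  also have "\<dots> = (\<Sum>i\<in>F. \<Sum>j\<in>J. T j (x i))"
    by (simp add: v T_sum) (rule sum.swap)
  also have "\<dots> = (\<Sum>i\<in>F. \<Sum>j\<in>{..i}. T j (x i))"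
    by (intro sum.cong sum.mono_neutral_right) (use finJ zero in \<open>auto simp: J_def\<close>)
  \<comment> \<open>Each inner sum is \<open>P i (x i)\<close>, and \<open>P i\<close> fixes
    \<open>x i\<close>.\<close>
  also have "\<dots> = v"
    by (simp add: v Px flip: P_eq_sum_T)
  finally show ?thesis
    using finite_subset[OF sub finJ] by (simp add: decomposition_def)
qed

lemma direct_sum_range_T:
  assumes "subspace_sum (\<lambda>i. range (P i)) = UNIV"
  shows "is_internal_direct_sum (\<lambda>i. range (T i))"
  unfolding is_internal_direct_sum_def
proof
  fix v
  obtain x where "decomposition (\<lambda>i. range (P i)) v x"
    using assms by (auto simp: subspace_sum_def)
  then show "\<exists>!y. decomposition (\<lambda>i. range (T i)) v y"
    using decomposition_range_T decomposition_range_T_unique by (metis (no_types, lifting) ext)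
qed

end

theorem theorem2p16:
  fixes scale :: "rat \<Rightarrow> 'v::ab_group_add \<Rightarrow> 'v"
    and ip :: "'v \<Rightarrow> 'v \<Rightarrow> rat"
    and V :: "'i::semilattice_inf \<Rightarrow> 'v set"
    and P :: "'i \<Rightarrow> 'v \<Rightarrow> 'v"
  assumes "rat_inner_product_space scale ip"
    and "\<And>i. module.subspace scale (V i)"
    and "\<And>i. is_projection scale (P i)"
    and "\<And>i. range (P i) = V i"
    and "\<exists>!z::'i. \<forall>k. \<not> k < z"
    and "\<And>i j :: 'i. finite {i..j}"
    and "\<And>i j. i \<le> j \<Longrightarrow> V i \<subseteq> V j"
    and "\<And>i. is_orthogonal_projection scale ip (P i)"
    and "\<And>i j. P i \<circ> P j = P (inf i j)"
    and "\<And>i j. P j \<circ> P i = P (inf i j)"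
    and "subspace_sum V = UNIV"
  shows "\<exists>T :: 'i \<Rightarrow> 'v \<Rightarrow> 'v.
      (\<forall>i. is_orthogonal_projection scale ip (T i)) \<and>
      (\<forall>i j. i \<noteq> j \<longrightarrow> T i \<circ> T j = (\<lambda>_. 0)) \<and>
      (\<forall>i. range (T i) \<subseteq> V i) \<and>
      (\<forall>i j. i \<noteq> j \<longrightarrow> orthogonal_sets ip (range (T i)) (range (T j))) \<and>
      is_internal_direct_sum (\<lambda>i. range (T i))"
proof -
  interpret rat_inner_product_space scale ip
    by (rule assms(1))
  obtain z :: 'i where "\<And>k. \<not> k < z"
    using assms(5) by blast
  then have "z \<le> k" for k
    by (rule minimal_is_least)
  \<comment> \<open>Local finiteness now yields the finite down-sets on which the recursion for
    \<open>T\<close> rests.\<close>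
  then have "{..i} = {z..i}" for i
    by auto
  then have fin: "finite {..i}" for i :: 'i
    using assms(6) by simp
  interpret meet_projections scale ip P
    by unfold_locales
      (use fin assms(8) fun_cong[OF assms(9)] in auto)
  have "range (P i) = V i" for i
    by (rule assms(4))
  then have V: "V = (\<lambda>i. range (P i))"
    by auto
  have "is_internal_direct_sum (\<lambda>i. range (T i))"
    using direct_sum_range_T assms(11) by (simp add: V)
  moreover have "T i \<circ> T j = (\<lambda>_. 0)" if "i \<noteq> j" for i j
    using that by (auto simp: T_T)
  ultimately show ?thesis
    using T_orthogonal_projection range_T_subset orthogonal_range_T by (intro exI[of _ T]) (simp add: V)
qed

end
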